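(* Let $n\ge p>0$ be integers and $\beta>0$. For all $U,\widetilde U\in\mathrm{St}(n,p)$, $$d_{\beta}(U,\widetilde U)\ge \min\{1,\sqrt\beta\}\,2\sqrt p\,\arcsin\left(\frac{\|U-\widetilde U\|_{\mathrm F}}{2\sqrt p}\right).$$
   Context: The Stiefel manifold is $\mathrm{St}(n,p)=\{U\in\mathbb{R}^{n\times p} : U^TU=I_p\}$, with tangent space $T_U\mathrm{St}(n,p)=\{\Delta\in\mathbb{R}^{n\times p} : U^T\Delta+\Delta^TU=0\}$; $\|\cdot\|_{\mathrm F}$ is the Frobenius norm. For $\beta>0$ the $\beta$-metric is $\langle\Delta,\widetilde\Delta\rangle_\beta=\mathrm{Tr}\big(\Delta^T(I_n-(1-\beta)UU^T)\widetilde\Delta\big)$ for $\Delta,\widetilde\Delta\in T_U\mathrm{St}(n,p)$, with norm $\|\Delta\|_\beta=\sqrt{\langle\Delta,\Delta\rangle_\beta}$. The length of a continuously differentiable curve $\gamma:[0,1]\to\mathrm{St}(n,p)$ is $l_\beta(\gamma)=\int_0^1\|\dot\gamma(t)\|_\beta\,dt$, and the geodesic $\beta$-distance is $d_\beta(U,\widetilde U)=\inf\{l_\beta(\gamma) : \gamma(0)=U,\ \gamma(1)=\widetilde U\}$, the infimum being over continuously differentiable curves in $\mathrm{St}(n,p)$. When $n=p$ the manifold has two connected components, and distances are considered between points of the same component. *)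

theory Defs
  imports "HOL-Analysis.Analysis" "HOL-Library.Extended_Real"
begin

text \<open>
  An \<open>n \<times> p\<close> matrix is an element of \<^typ>\<open>real ^ 'p ^ 'n\<close>, with \<open>n = CARD('n)\<close> and \<open>p = CARD('p)\<close>.
  The library norm of this type is the Frobenius norm:
\<close>

lemma norm_matrix_eq_frobenius:
  fixes A :: "real ^ 'p ^ 'n"
  shows "norm A = sqrt (\<Sum>i\<in>UNIV. \<Sum>j\<in>UNIV. (A $ i $ j)\<^sup>2)"
  by (simp add: norm_vec_def L2_set_def sum_nonneg)

lemma norm_matrix_eq_trace:
  fixes A :: "real ^ 'p ^ 'n"
  shows "norm A = sqrt (trace (transpose A ** A))"
  by (subst norm_matrix_eq_frobenius, subst sum.swap)
    (simp add: trace_def matrix_matrix_mult_def transpose_def power2_eq_square)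

definition stiefel :: "(real ^ 'p ^ 'n) set" where
  "stiefel = {U. transpose U ** U = mat 1}"

definition stiefel_tangent :: "real ^ 'p ^ 'n \<Rightarrow> (real ^ 'p ^ 'n) set" where
  "stiefel_tangent U = {\<Delta>. transpose U ** \<Delta> + transpose \<Delta> ** U = 0}"

text \<open>The formula is written for arbitrary matrices; it is only ever evaluated on tangent vectors at
  \<open>U\<close>, see \<open>stiefel_curve_derivative_tangent\<close> below.\<close>

definition beta_inner :: "real \<Rightarrow> real ^ 'p ^ 'n \<Rightarrow> real ^ 'p ^ 'n \<Rightarrow> real ^ 'p ^ 'n \<Rightarrow> real" where
  "beta_inner \<beta> U \<Delta> \<Delta>' =
     trace (transpose \<Delta> ** (mat 1 - (1 - \<beta>) *\<^sub>R (U ** transpose U)) ** \<Delta>')"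

definition beta_norm :: "real \<Rightarrow> real ^ 'p ^ 'n \<Rightarrow> real ^ 'p ^ 'n \<Rightarrow> real" where
  "beta_norm \<beta> U \<Delta> = sqrt (beta_inner \<beta> U \<Delta> \<Delta>)"

text \<open>Derivatives are taken within \<open>[0,1]\<close>, hence one-sided at the endpoints; values of \<open>\<gamma>\<close> outside
  \<open>[0,1]\<close> play no role.\<close>

definition stiefel_C1_curve :: "(real \<Rightarrow> real ^ 'p ^ 'n) \<Rightarrow> bool" where
  "stiefel_C1_curve \<gamma> \<longleftrightarrow>
     (\<forall>t\<in>{0..1}. \<gamma> t \<in> stiefel) \<and>
     (\<forall>t\<in>{0..1}. \<gamma> differentiable (at t within {0..1})) \<and>
     continuous_on {0..1} (\<lambda>t. vector_derivative \<gamma> (at t within {0..1}))"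

definition beta_length :: "real \<Rightarrow> (real \<Rightarrow> real ^ 'p ^ 'n) \<Rightarrow> real" where
  "beta_length \<beta> \<gamma> =
     integral {0..1} (\<lambda>t. beta_norm \<beta> (\<gamma> t) (vector_derivative \<gamma> (at t within {0..1})))"

text \<open>The infimum is taken in the extended reals, so that the distance between points that no curve
  joins (different components, which occur only for \<open>n = p\<close>) is \<open>\<infinity>\<close>.\<close>

definition beta_dist :: "real \<Rightarrow> real ^ 'p ^ 'n \<Rightarrow> real ^ 'p ^ 'n \<Rightarrow> ereal" where
  "beta_dist \<beta> U V =
     (INF \<gamma> \<in> {\<gamma>. stiefel_C1_curve \<gamma> \<and> \<gamma> 0 = U \<and> \<gamma> 1 = V}. ereal (beta_length \<beta> \<gamma>))"

lemma bounded_bilinear_transpose_mult: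
  "bounded_bilinear (\<lambda>(A :: real ^ 'p ^ 'n) (B :: real ^ 'p ^ 'n). transpose A ** B)"
proof -
  have "bilinear (\<lambda>(A :: real ^ 'p ^ 'n) (B :: real ^ 'p ^ 'n). transpose A ** B)"
    unfolding bilinear_def
    by (intro conjI allI linearI)
      (simp_all add: vec_eq_iff matrix_matrix_mult_def transpose_def algebra_simps
        sum.distrib sum_distrib_left)
  then show ?thesis
    by (simp add: bilinear_conv_bounded_bilinear)
qed

lemma stiefel_curve_derivative_tangent:
  fixes \<gamma> :: "real \<Rightarrow> real ^ 'p ^ 'n"
  assumes \<gamma>: "stiefel_C1_curve \<gamma>" and t: "t \<in> {0..1}"
  shows "vector_derivative \<gamma> (at t within {0..1}) \<in> stiefel_tangent (\<gamma> t)"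
proof -
  let ?D = "vector_derivative \<gamma> (at t within {0..1})"
  let ?g = "\<lambda>t. transpose (\<gamma> t) ** \<gamma> t"
  have d: "(\<gamma> has_vector_derivative ?D) (at t within {0..1})"
    using \<gamma> t by (simp add: stiefel_C1_curve_def vector_derivative_works)
  have 1: "(?g has_vector_derivative (transpose (\<gamma> t) ** ?D + transpose ?D ** \<gamma> t))
      (at t within {0..1})"
    by (rule bounded_bilinear.has_vector_derivative[OF bounded_bilinear_transpose_mult d d])
  have "(?g has_vector_derivative 0) (at t within {0..1})"
    by (rule has_vector_derivative_transform[OF t _ has_vector_derivative_const[of "mat 1"]])
      (use \<gamma> in \<open>auto simp: stiefel_C1_curve_def stiefel_def\<close>)
  with 1 have "transpose (\<gamma> t) ** ?D + transpose ?D ** \<gamma> t = 0"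
    using t by (intro vector_derivative_unique_within[OF _ 1])
      (auto simp: trivial_limit_within islimpt_Icc)
  then show ?thesis
    by (simp add: stiefel_tangent_def)
qed

end

theory Submission
  imports Defs
begin

text \<open>
  Since \<open>norm (U\<^sup>T \<Delta>) \<le> norm \<Delta>\<close> for \<open>U\<close> with orthonormal columns, the \<open>\<beta>\<close>-norm dominates
  \<open>min 1 (sqrt \<beta>)\<close> times the Frobenius norm. The Stiefel manifold lies on the Frobenius sphere of
  radius \<open>r = sqrt p\<close>, and a curve on that sphere is at least as long as the great-circle arc between
  its endpoints, whose length is \<open>r * arccos (inner U V / r\<^sup>2) = 2 * r * arcsin (norm (U - V) / (2 * r))\<close>.
\<close>

section \<open>Frobenius inner product and matrices with orthonormal columns\<close>

lemma inner_matrix_eq_trace: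
  fixes A B :: "real ^ 'p ^ 'n"
  shows "inner A B = trace (transpose A ** B)"
proof -
  have "inner A B = (\<Sum>i\<in>UNIV. \<Sum>j\<in>UNIV. A $ i $ j * B $ i $ j)"
    by (simp add: inner_vec_def)
  also have "\<dots> = (\<Sum>j\<in>UNIV. \<Sum>i\<in>UNIV. A $ i $ j * B $ i $ j)"
    by (rule sum.swap)
  finally show ?thesis
    by (simp add: trace_def matrix_matrix_mult_def transpose_def)
qed

lemma inner_matrix_mult_adjoint:
  fixes U :: "real ^ 'p ^ 'n" and A :: "real ^ 'm ^ 'n" and B :: "real ^ 'm ^ 'p"
  shows "inner A (U ** B) = inner (transpose U ** A) B"
  by (simp add: inner_matrix_eq_trace matrix_transpose_mul matrix_mul_assoc)

lemma norm_stiefel_mult: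
  fixes U :: "real ^ 'p ^ 'n" and B :: "real ^ 'm ^ 'p"
  assumes "U \<in> stiefel"
  shows "norm (U ** B) = norm B"
  using assms
  by (simp add: norm_eq inner_matrix_mult_adjoint matrix_mul_assoc stiefel_def)

text \<open>With \<open>B = transpose U ** A\<close>, adjointness gives |B|^2 = <A, U B>.
  Cauchy-Schwarz and |U B| = |B| bound this by |A| |B|, and |B| cancels unless it is 0.\<close>

lemma norm_transpose_stiefel_mult_le:
  fixes U :: "real ^ 'p ^ 'n" and A :: "real ^ 'm ^ 'n"
  assumes "U \<in> stiefel"
  shows "norm (transpose U ** A) \<le> norm A"
proof -
  let ?B = "transpose U ** A"
  have "norm ?B * norm ?B = inner A (U ** ?B)"
    by (simp add: inner_matrix_mult_adjoint flip: power2_eq_square power2_norm_eq_inner)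
  also have "\<dots> \<le> norm A * norm ?B"
    using norm_cauchy_schwarz[of A "U ** ?B"] assms by (simp add: norm_stiefel_mult)
  finally show ?thesis
    by (cases "norm ?B = 0") simp_all
qed

lemma norm_stiefel:
  fixes U :: "real ^ 'p ^ 'n"
  assumes "U \<in> stiefel"
  shows "norm U = sqrt (real CARD('p))"
  using assms by (simp add: norm_matrix_eq_trace stiefel_def trace_I)

lemma matrix_diff_rdistrib:
  fixes A B :: "'a::ring_1 ^ 'm ^ 'n" and C :: "'a ^ 'k ^ 'm"
  shows "(A - B) ** C = A ** C - B ** C"
  by (simp add: vec_eq_iff matrix_matrix_mult_def left_diff_distrib sum_subtractf)

section \<open>Comparison of the \<beta>-norm with the Frobenius norm\<close>

lemma beta_inner_self:
  fixes U \<Delta> :: "real ^ 'p ^ 'n"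
  shows "beta_inner \<beta> U \<Delta> \<Delta> = (norm \<Delta>)\<^sup>2 - (1 - \<beta>) * (norm (transpose U ** \<Delta>))\<^sup>2"
proof -
  have "(mat 1 - (1 - \<beta>) *\<^sub>R (U ** transpose U)) ** \<Delta> =
      \<Delta> - (1 - \<beta>) *\<^sub>R (U ** (transpose U ** \<Delta>))"
    by (simp add: matrix_diff_rdistrib matrix_mul_assoc flip: scalar_matrix_assoc)
  then have "beta_inner \<beta> U \<Delta> \<Delta> = inner \<Delta> (\<Delta> - (1 - \<beta>) *\<^sub>R (U ** (transpose U ** \<Delta>)))"
    by (simp add: beta_inner_def inner_matrix_eq_trace flip: matrix_mul_assoc)
  then show ?thesis
    by (simp add: inner_diff_right inner_matrix_mult_adjoint power2_norm_eq_inner)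
qed

text \<open>The squared \<beta>-norm is N - (1 - \<beta>) M with 0 \<le> M \<le> N, affine in M. Its
  minimum is at M = N when \<beta> \<le> 1, with value \<beta> N, and at M = 0 otherwise, with value
  N.\<close>

lemma beta_norm_ge:
  fixes U \<Delta> :: "real ^ 'p ^ 'n"
  assumes "\<beta> > 0" "U \<in> stiefel"
  shows "min 1 (sqrt \<beta>) * norm \<Delta> \<le> beta_norm \<beta> U \<Delta>"
proof -
  let ?N = "(norm \<Delta>)\<^sup>2" and ?M = "(norm (transpose U ** \<Delta>))\<^sup>2"
  have M: "0 \<le> ?M" "?M \<le> ?N"
    using norm_transpose_stiefel_mult_le[OF assms(2)] by (simp_all add: power_mono)
  have "min 1 \<beta> * ?N \<le> ?N - (1 - \<beta>) * ?M"
  proof (cases "\<beta> \<le> 1")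
    case True
    then have "(1 - \<beta>) * ?M \<le> (1 - \<beta>) * ?N"
      using M by (intro mult_left_mono) auto
    with True show ?thesis by (simp add: algebra_simps)
  next
    case False
    then have "0 \<le> (\<beta> - 1) * ?M" using M by simp
    with False show ?thesis by (simp add: algebra_simps)
  qed
  moreover have "(min 1 (sqrt \<beta>))\<^sup>2 = min 1 \<beta>"
    using assms(1) by (auto simp: min_def)
  ultimately have "(min 1 (sqrt \<beta>) * norm \<Delta>)\<^sup>2 \<le> beta_inner \<beta> U \<Delta> \<Delta>"
    by (simp add: beta_inner_self power_mult_distrib)
  then show ?thesis
    unfolding beta_norm_def by (rule real_le_rsqrt)
qed

section \<open>Length of curves on a sphere\<close>

text \<open>A vector \<open>w\<close> orthogonal to \<open>x\<close> sees only the component of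
  \<open>y\<close> orthogonal to \<open>x\<close>. By Pythagoras that component has length r times
  the sine of the angle between \<open>x\<close> and \<open>y\<close>. This sine cancels the
  denominator in the derivative of \<open>arccos\<close>.\<close>

lemma inner_orthogonal_bound:
  fixes x y w :: "'a::real_inner"
  assumes "norm x = r" "norm y = r" "inner x w = 0" "r > 0"
  shows "\<bar>inner w y\<bar> \<le> r * norm w * sqrt (1 - (inner x y / r\<^sup>2)\<^sup>2)"
proof -
  let ?f = "inner x y / r\<^sup>2"
  have xx: "inner x x = r\<^sup>2" and yy: "inner y y = r\<^sup>2"
    using assms by (simp_all flip: power2_norm_eq_inner)
  have "(norm (y - ?f *\<^sub>R x))\<^sup>2 = r\<^sup>2 * (1 - ?f\<^sup>2)"
    using \<open>r > 0\<close>
    by (simp add: power2_norm_eq_inner inner_diff_left inner_diff_right xx yy inner_commute[of y x])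
      (simp add: field_simps power2_eq_square)
  then have "norm (y - ?f *\<^sub>R x) = sqrt (r\<^sup>2 * (1 - ?f\<^sup>2))"
    by (metis norm_ge_zero real_sqrt_unique)
  then have n: "norm (y - ?f *\<^sub>R x) = r * sqrt (1 - ?f\<^sup>2)"
    using \<open>r > 0\<close> by (simp add: real_sqrt_mult)
  have "inner w y = inner w (y - ?f *\<^sub>R x)"
    using assms(3) by (simp add: inner_diff_right inner_commute)
  then show ?thesis
    using Cauchy_Schwarz_ineq2[of w "y - ?f *\<^sub>R x"] by (simp add: n mult_ac)
qed

text \<open>The factor \<open>c < 1\<close> keeps the argument of \<open>arccos\<close> away from \<open>\<plusminus>1\<close>, where \<open>arccos\<close> is not
  differentiable; it is removed by letting \<open>c\<close> tend to \<open>1\<close>.\<close>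

lemma spherical_curve_length_scaled:
  fixes \<gamma> \<gamma>' :: "real \<Rightarrow> 'a::real_inner"
  assumes sph: "\<And>t. t \<in> {0..1} \<Longrightarrow> norm (\<gamma> t) = r" and r: "r > 0"
    and deriv: "\<And>t. t \<in> {0..1} \<Longrightarrow> (\<gamma> has_vector_derivative \<gamma>' t) (at t within {0..1})"
    and cont: "continuous_on {0..1} \<gamma>'"
    and c: "0 < c" "c < 1"
  shows "r * (arccos (c * (inner (\<gamma> 0) (\<gamma> 1) / r\<^sup>2)) - arccos c) \<le> integral {0..1} (\<lambda>t. norm (\<gamma>' t))"
proof -
  \<comment> \<open>\<open>f t\<close> is the cosine of the angle between \<open>\<gamma> t\<close>
    and the starting point; \<open>D\<close> will be the derivative of
    \<open>arccos (c * f t)\<close>.\<close>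
  define f where "f t = inner (\<gamma> t) (\<gamma> 0) / r\<^sup>2" for t
  define f' where "f' t = inner (\<gamma>' t) (\<gamma> 0) / r\<^sup>2" for t
  define D where "D t = inverse (- sqrt (1 - (c * f t)\<^sup>2)) * (c * f' t)" for t
  have f_le: "\<bar>f t\<bar> \<le> 1" if "t \<in> {0..1}" for t
    using Cauchy_Schwarz_ineq2[of "\<gamma> t" "\<gamma> 0"] sph[OF that] sph[of 0] r
    by (simp add: f_def power2_eq_square)
  have cf: "\<bar>c * f t\<bar> < 1" if "t \<in> {0..1}" for t
  proof -
    have "\<bar>c * f t\<bar> \<le> c * 1"
      unfolding abs_mult using f_le[OF that] c by (intro mult_mono) auto
    with c show ?thesis by simp
  qed
  \<comment> \<open>Differentiating the constant |\<gamma>|^2 = r^2 shows that the velocity is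
    tangent to the sphere.\<close>
  have orth: "inner (\<gamma> t) (\<gamma>' t) = 0" if t: "t \<in> {0..1}" for t
  proof -
    have 1: "((\<lambda>t. inner (\<gamma> t) (\<gamma> t)) has_vector_derivative
        (inner (\<gamma> t) (\<gamma>' t) + inner (\<gamma>' t) (\<gamma> t))) (at t within {0..1})"
      by (rule bounded_bilinear.has_vector_derivative[OF bounded_bilinear_inner deriv deriv])
        (use t in auto)
    have "((\<lambda>t. inner (\<gamma> t) (\<gamma> t)) has_vector_derivative 0) (at t within {0..1})"
      by (rule has_vector_derivative_transform[OF t _ has_vector_derivative_const[of "r\<^sup>2"]])
        (simp add: sph flip: power2_norm_eq_inner)
    with 1 have "inner (\<gamma> t) (\<gamma>' t) + inner (\<gamma>' t) (\<gamma> t) = 0"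
      using t by (intro vector_derivative_unique_within[OF _ 1])
        (auto simp: trivial_limit_within islimpt_Icc)
    then show ?thesis by (simp add: inner_commute)
  qed
  have df: "((\<lambda>t. c * f t) has_real_derivative c * f' t) (at t within {0..1})"
    if "t \<in> {0..1}" for t
    using bounded_linear.has_vector_derivative[OF bounded_linear_inner_left deriv[OF that]]
    unfolding f_def f'_def
    by (intro DERIV_cmult DERIV_cdivide) (simp add: has_real_derivative_iff_has_vector_derivative)
  have dA: "((\<lambda>t. arccos (c * f t)) has_vector_derivative D t) (at t within {0..1})"
    if "t \<in> {0..1}" for t
    using DERIV_chain2[OF DERIV_arccos df[OF that]] cf[OF that]
    by (simp add: D_def has_real_derivative_iff_has_vector_derivative abs_less_iff)
  have D_le: "D t \<le> norm (\<gamma>' t) / r" if t: "t \<in> {0..1}" for t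
  proof -
    have pos: "0 < 1 - (c * f t)\<^sup>2"
      using cf[OF t] by (simp add: abs_square_less_1)
    \<comment> \<open>This is c^2 - c^2 f^2 \<le> 1 - c^2 f^2. It lets the true sine, scaled by
      \<open>c\<close>, be absorbed by the root in the denominator of \<open>D\<close>.\<close>
    have "(c * sqrt (1 - (f t)\<^sup>2))\<^sup>2 \<le> 1 - (c * f t)\<^sup>2"
      using f_le[OF t] c
      by (simp add: power_mult_distrib abs_square_le_1 right_diff_distrib power_le_one)
    then have le: "c * sqrt (1 - (f t)\<^sup>2) \<le> sqrt (1 - (c * f t)\<^sup>2)"
      by (rule real_le_rsqrt)
    have "\<bar>f' t\<bar> = \<bar>inner (\<gamma>' t) (\<gamma> 0)\<bar> / r\<^sup>2"
      by (simp add: f'_def)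
    also have "\<dots> \<le> (r * norm (\<gamma>' t) * sqrt (1 - (f t)\<^sup>2)) / r\<^sup>2"
      unfolding f_def
      by (intro divide_right_mono inner_orthogonal_bound) (use sph t r orth in auto)
    also have "\<dots> = norm (\<gamma>' t) / r * sqrt (1 - (f t)\<^sup>2)"
      by (simp add: power2_eq_square)
    finally have "c * \<bar>f' t\<bar> \<le> c * (norm (\<gamma>' t) / r * sqrt (1 - (f t)\<^sup>2))"
      using c by (intro mult_left_mono) auto
    also have "\<dots> = norm (\<gamma>' t) / r * (c * sqrt (1 - (f t)\<^sup>2))"
      by simp
    also have "\<dots> \<le> norm (\<gamma>' t) / r * sqrt (1 - (c * f t)\<^sup>2)"
      using le r by (intro mult_left_mono) auto
    finally have "c * \<bar>f' t\<bar> / sqrt (1 - (c * f t)\<^sup>2) \<le> norm (\<gamma>' t) / r"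
      using pos by (simp add: pos_divide_le_eq)
    moreover have "\<bar>D t\<bar> = c * \<bar>f' t\<bar> / sqrt (1 - (c * f t)\<^sup>2)"
      using c pos by (simp add: D_def abs_mult divide_inverse)
    ultimately show ?thesis by (metis abs_ge_self order_trans)
  qed
  have DI: "(D has_integral arccos (c * f 1) - arccos (c * f 0)) {0..1}"
    by (rule fundamental_theorem_of_calculus) (use dA in auto)
  have "((\<lambda>t. norm (\<gamma>' t)) has_integral integral {0..1} (\<lambda>t. norm (\<gamma>' t))) {0..1}"
    by (intro integrable_integral integrable_continuous_interval continuous_intros cont)
  then have NI: "((\<lambda>t. norm (\<gamma>' t) / r) has_integral integral {0..1} (\<lambda>t. norm (\<gamma>' t)) / r) {0..1}"
    by (rule has_integral_divide)
  have "arccos (c * f 1) - arccos (c * f 0) \<le> integral {0..1} (\<lambda>t. norm (\<gamma>' t)) / r"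
    by (rule has_integral_le[OF DI NI]) (rule D_le)
  \<comment> \<open>The scaled angle therefore starts at \<open>arccos c\<close> rather than 0,
    which accounts for the subtracted term in the bound.\<close>
  moreover have "f 0 = 1"
    using sph[of 0] r by (simp add: f_def flip: power2_norm_eq_inner)
  ultimately have "r * (arccos (c * f 1) - arccos c) \<le> integral {0..1} (\<lambda>t. norm (\<gamma>' t))"
    using r by (simp add: pos_le_divide_eq mult.commute)
  then show ?thesis
    by (simp add: f_def inner_commute)
qed

text \<open>The scaled bound passes to the limit c = 1 from the left: \<open>arccos\<close> is
  continuous on all of [-1, 1], endpoints included, and the correction \<open>arccos c\<close> tends
  to 0.\<close>

lemma spherical_curve_length:
  fixes \<gamma> \<gamma>' :: "real \<Rightarrow> 'a::real_inner"
  assumes sph: "\<And>t. t \<in> {0..1} \<Longrightarrow> norm (\<gamma> t) = r" and r: "r > 0"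
    and deriv: "\<And>t. t \<in> {0..1} \<Longrightarrow> (\<gamma> has_vector_derivative \<gamma>' t) (at t within {0..1})"
    and cont: "continuous_on {0..1} \<gamma>'"
  shows "r * arccos (inner (\<gamma> 0) (\<gamma> 1) / r\<^sup>2) \<le> integral {0..1} (\<lambda>t. norm (\<gamma>' t))"
proof -
  let ?y = "inner (\<gamma> 0) (\<gamma> 1) / r\<^sup>2"
  let ?F = "\<lambda>c. r * (arccos (c * ?y) - arccos c)"
  have y: "\<bar>?y\<bar> \<le> 1"
    using Cauchy_Schwarz_ineq2[of "\<gamma> 0" "\<gamma> 1"] sph[of 0] sph[of 1] r
    by (simp add: power2_eq_square)
  have "\<bar>c * ?y\<bar> \<le> 1" if "c \<in> {0..1}" for c
    unfolding abs_mult using that y by (intro mult_le_one) simp_all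
  then have "\<forall>c\<in>{0..1}. -1 \<le> c * ?y \<and> c * ?y \<le> 1"
    by (simp only: abs_le_iff minus_le_iff) blast
  then have "continuous_on {0..1} ?F"
    by (intro continuous_intros) simp_all
  then have "(?F \<longlongrightarrow> ?F 1) (at 1 within {0..1})"
    unfolding continuous_on_def by (rule bspec) simp
  then have lim: "(?F \<longlongrightarrow> ?F 1) (at_left 1)"
    by (simp add: at_within_Icc_at_left)
  have "eventually (\<lambda>c. c \<in> {0<..<1::real}) (at_left 1)"
    by (rule eventually_at_leftI[of 0]) auto
  then have "eventually (\<lambda>c. ?F c \<le> integral {0..1} (\<lambda>t. norm (\<gamma>' t))) (at_left 1)"
    by eventually_elim (use spherical_curve_length_scaled[OF sph r deriv cont] in auto)
  from tendsto_upperbound[OF lim this] show ?thesis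
    by simp
qed

text \<open>With s = |x - y| / (2 r), expanding |x - y|^2 gives <x, y> / r^2 = 1 - 2 s^2, the cosine
  of twice \<open>arcsin s\<close>. Since \<open>arcsin s\<close> lies in [0, pi/2], its double is
  in the range where \<open>arccos\<close> inverts \<open>cos\<close>.\<close>

lemma arccos_inner_eq_arcsin_chord:
  fixes x y :: "'a::real_inner"
  assumes x: "norm x = r" and y: "norm y = r" and r: "r > 0"
  shows "arccos (inner x y / r\<^sup>2) = 2 * arcsin (norm (x - y) / (2 * r))"
proof -
  let ?s = "norm (x - y) / (2 * r)"
  have "norm (x - y) \<le> 2 * r"
    using norm_triangle_ineq4[of x y] x y by simp
  then have s: "0 \<le> ?s" "?s \<le> 1"
    using r by simp_all
  have th: "0 \<le> arcsin ?s" "arcsin ?s \<le> pi / 2"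
    using s arcsin_le_arcsin[of 0 ?s] arcsin_bounded[of ?s] by auto
  have "(norm (x - y))\<^sup>2 = 2 * r\<^sup>2 - 2 * inner x y"
    using x y dot_norm_neg[of x y] by (simp add: field_simps)
  then have "inner x y / r\<^sup>2 = 1 - 2 * ?s\<^sup>2"
    using r by (simp add: field_simps power2_eq_square)
  also have "\<dots> = cos (2 * arcsin ?s)"
    using s by (simp add: cos_double_sin)
  finally show ?thesis
    using th by (simp add: arccos_cos)
qed

section \<open>Passing to lengths and to the distance\<close>

lemma beta_length_ge:
  fixes \<gamma> :: "real \<Rightarrow> real ^ 'p ^ 'n"
  assumes \<gamma>: "stiefel_C1_curve \<gamma>" and \<beta>: "\<beta> > 0"
  shows "min 1 (sqrt \<beta>) *
      integral {0..1} (\<lambda>t. norm (vector_derivative \<gamma> (at t within {0..1}))) \<le> beta_length \<beta> \<gamma>"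
proof -
  define \<gamma>' where "\<gamma>' t = vector_derivative \<gamma> (at t within {0..1})" for t
  have cont': "continuous_on {0..1} \<gamma>'" and st: "\<And>t. t \<in> {0..1} \<Longrightarrow> \<gamma> t \<in> stiefel"
    and cont: "continuous_on {0..1} \<gamma>"
    using \<gamma> by (auto simp: stiefel_C1_curve_def \<gamma>'_def differentiable_on_def
        intro!: differentiable_imp_continuous_on)
  \<comment> \<open>Continuity supplies integrability, without which \<open>integral\<close> would
    default to 0. Expanding by \<open>beta_inner_self\<close> makes the integrand visibly
    continuous.\<close>
  have "continuous_on {0..1} (\<lambda>t. beta_norm \<beta> (\<gamma> t) (\<gamma>' t))"
    unfolding beta_norm_def beta_inner_self
    by (intro continuous_intros cont cont'
        bounded_bilinear.continuous_on[OF bounded_bilinear_transpose_mult])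
  then have "integral {0..1} (\<lambda>t. min 1 (sqrt \<beta>) * norm (\<gamma>' t)) \<le>
      integral {0..1} (\<lambda>t. beta_norm \<beta> (\<gamma> t) (\<gamma>' t))"
    by (intro integral_le integrable_continuous_interval continuous_intros cont' beta_norm_ge \<beta> st)
  then show ?thesis
    by (simp add: beta_length_def \<gamma>'_def)
qed

theorem corollary5p4:
  fixes \<beta> :: real and U V :: "real ^ 'p ^ 'n"
  assumes "CARD('p) \<le> CARD('n)"
    and "\<beta> > 0"
    and "U \<in> stiefel" and "V \<in> stiefel"
  shows "beta_dist \<beta> U V \<ge>
    ereal (min 1 (sqrt \<beta>) * (2 * sqrt (real CARD('p))) *
      arcsin (norm (U - V) / (2 * sqrt (real CARD('p)))))"
  unfolding beta_dist_def
proof (rule INF_greatest)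
  \<comment> \<open>A bound for each admissible curve suffices; if there is none, the infimum is
    \<infinity> and the claim is trivial.\<close>
  fix \<gamma> :: "real \<Rightarrow> real ^ 'p ^ 'n"
  assume "\<gamma> \<in> {\<gamma>. stiefel_C1_curve \<gamma> \<and> \<gamma> 0 = U \<and> \<gamma> 1 = V}"
  then have \<gamma>: "stiefel_C1_curve \<gamma>" and ends: "\<gamma> 0 = U" "\<gamma> 1 = V"
    by auto
  let ?r = "sqrt (real CARD('p))"
  let ?I = "integral {0..1} (\<lambda>t. norm (vector_derivative \<gamma> (at t within {0..1})))"
  \<comment> \<open>By \<open>norm_stiefel\<close> the curve stays on the Frobenius sphere of radius
    \<open>?r\<close>.\<close>
  have "?r * arccos (inner (\<gamma> 0) (\<gamma> 1) / ?r\<^sup>2) \<le> ?I"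
    using \<gamma> by (intro spherical_curve_length)
      (auto simp: stiefel_C1_curve_def norm_stiefel vector_derivative_works)
  moreover have "arccos (inner U V / ?r\<^sup>2) = 2 * arcsin (norm (U - V) / (2 * ?r))"
    using assms by (intro arccos_inner_eq_arcsin_chord) (auto simp: norm_stiefel)
  ultimately have "2 * ?r * arcsin (norm (U - V) / (2 * ?r)) \<le> ?I"
    by (simp add: ends mult_ac)
  then have "min 1 (sqrt \<beta>) * (2 * ?r * arcsin (norm (U - V) / (2 * ?r))) \<le> min 1 (sqrt \<beta>) * ?I"
    using assms(2) by (intro mult_left_mono) auto
  also have "\<dots> \<le> beta_length \<beta> \<gamma>"
    by (rule beta_length_ge[OF \<gamma> assms(2)])
  finally show "ereal (min 1 (sqrt \<beta>) * (2 * ?r) * arcsin (norm (U - V) / (2 * ?r)))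
      \<le> ereal (beta_length \<beta> \<gamma>)"
    by (simp add: mult.assoc)
qed

end
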